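(* The $\mathsf{GEM}(0,\theta)$ models for $0<\theta<\infty$ are the only residual allocation models with i.i.d. factors such that for all sufficiently large $n$ the gaps between order statistics in a sample of size $n$ are independent. That is, let $H_1,H_2,\dots$ be i.i.d. random variables with values in $(0,1)$, let $P_\bullet$ be the random discrete distribution $P_j:=H_j\prod_{i=1}^{j-1}(1-H_i)$, and let $X_1,X_2,\dots$ be an i.i.d. sample from $P_\bullet$ with gaps $G_{1:n},\dots,G_{n:n}$. Then $G_{1:n},\dots,G_{n:n}$ are independent for all sufficiently large $n$ if and only if there is $\theta\in(0,\infty)$ such that $H_1$ has the beta$(1,\theta)$ distribution.
   Context: An i.i.d. sample from a random discrete distribution $P_\bullet=(P_1,P_2,\dots)$ on $\{1,2,\dots\}$ means that, conditionally given $P_\bullet$, the variables $X_1,X_2,\dots$ are i.i.d. with $\mathbb{P}(X_i=b\mid P_\bullet)=P_b$. With order statistics $X_{1:n}\le\cdots\le X_{n:n}$ of $X_1,\dots,X_n$, the gaps are $G_{i:n}:=X_{n+1-i:n}-X_{n-i:n}$ for $1\le i\le n-1$ and $G_{n:n}:=X_{1:n}-1$. A residual allocation model is a random discrete distribution of the form $P_j=H_j\prod_{i<j}(1-H_i)$ with independent factors $H_i\in(0,1)$ such that $\prod_{i=1}^\infty(1-H_i)=0$ almost surely (automatic for i.i.d. factors). The $\mathsf{GEM}(0,\theta)$ model is the one with $H_i$ i.i.d. beta$(1,\theta)$ (density $\theta(1-x)^{\theta-1}$ on $(0,1)$). *)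

theory Defs
  imports "HOL-Probability.Probability"
begin

text \<open>All sequences are indexed by \<open>{1..}\<close>; their entries at index 0 play no role.\<close>

text \<open>As usual, the next two notions are meaningful only when \<open>F\<close> is a sub-sigma-algebra
  of \<open>M\<close>.\<close>

definition cond_prob_given :: "'a measure \<Rightarrow> 'a measure \<Rightarrow> 'a set \<Rightarrow> 'a \<Rightarrow> real" where
  "cond_prob_given M F A = real_cond_exp M F (indicator A)"

definition cond_indep_vars ::
  "'a measure \<Rightarrow> 'a measure \<Rightarrow> ('i \<Rightarrow> 'b measure) \<Rightarrow> ('i \<Rightarrow> 'a \<Rightarrow> 'b) \<Rightarrow> 'i set \<Rightarrow> bool" where
  "cond_indep_vars M F N X I \<longleftrightarrow>
     (\<forall>i\<in>I. X i \<in> measurable M (N i)) \<and>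
     (\<forall>J A. J \<subseteq> I \<and> finite J \<and> (\<forall>j\<in>J. A j \<in> sets (N j)) \<longrightarrow>
        (AE w in M. cond_prob_given M F {v \<in> space M. \<forall>j\<in>J. X j v \<in> A j} w
                  = (\<Prod>j\<in>J. cond_prob_given M F {v \<in> space M. X j v \<in> A j} w)))"

text \<open>The sigma-algebra on the sample space generated by \<open>P\<^sub>1, P\<^sub>2, \<dots>\<close>; only its
  space and sets matter.\<close>

definition sigma_seq :: "'a measure \<Rightarrow> (nat \<Rightarrow> 'a \<Rightarrow> real) \<Rightarrow> 'a measure" where
  "sigma_seq M P =
     vimage_algebra (space M) (\<lambda>w. \<lambda>j\<in>{1..}. P j w) (Pi\<^sub>M {1..} (\<lambda>_. borel))"

definition iid_sample_from :: "'a measure \<Rightarrow> (nat \<Rightarrow> 'a \<Rightarrow> real) \<Rightarrow> (nat \<Rightarrow> 'a \<Rightarrow> nat) \<Rightarrow> bool" where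
  "iid_sample_from M P X \<longleftrightarrow>
     (\<forall>j\<ge>1. P j \<in> borel_measurable M) \<and>
     cond_indep_vars M (sigma_seq M P) (\<lambda>_. count_space {1..}) X {1..} \<and>
     (\<forall>i\<ge>1. \<forall>b\<ge>1. AE w in M. cond_prob_given M (sigma_seq M P) {v \<in> space M. X i v = b} w = P b w)"

definition residual_allocation :: "(nat \<Rightarrow> 'a \<Rightarrow> real) \<Rightarrow> nat \<Rightarrow> 'a \<Rightarrow> real" where
  "residual_allocation H j w = H j w * (\<Prod>i\<in>{1..<j}. 1 - H i w)"

definition iid_factors :: "'a measure \<Rightarrow> (nat \<Rightarrow> 'a \<Rightarrow> real) \<Rightarrow> bool" where
  "iid_factors M H \<longleftrightarrow>
     prob_space.indep_vars M (\<lambda>_. borel) H {1..} \<and>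
     (\<forall>i\<ge>1. distr M borel (H i) = distr M borel (H 1)) \<and>
     (\<forall>i\<ge>1. \<forall>w\<in>space M. H i w \<in> {0<..<1})"

text \<open>\<open>order_stat x n k\<close> is the \<open>k\<close>-th smallest of \<open>x 1, \<dots>, x n\<close>, for \<open>1 \<le> k \<le> n\<close>.\<close>

definition order_stat :: "(nat \<Rightarrow> 'b::linorder) \<Rightarrow> nat \<Rightarrow> nat \<Rightarrow> 'b" where
  "order_stat x n k = sort (map x [1..<Suc n]) ! (k - 1)"

text \<open>For \<open>1 \<le> i \<le> n\<close> and positive \<open>x 1, \<dots>, x n\<close> none of these subtractions of natural
  numbers truncates.\<close>

definition gap :: "(nat \<Rightarrow> nat) \<Rightarrow> nat \<Rightarrow> nat \<Rightarrow> nat" where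
  "gap x n i = (if i = n then order_stat x n 1 - 1
                else order_stat x n (n + 1 - i) - order_stat x n (n - i))"

text \<open>The density of the beta\<open>(1, \<theta>)\<close> distribution.\<close>

definition beta1_density :: "real \<Rightarrow> real \<Rightarrow> real" where
  "beta1_density \<theta> x = (if 0 < x \<and> x < 1 then \<theta> * (1 - x) powr (\<theta> - 1) else 0)"

end

theory Submission
  imports Defs "HOL-Combinatorics.Multiset_Permutations"
begin

text \<open>
  The gap \<open>G\<^sub>i\<close> is the number of \<open>b \<ge> 1\<close> such that exactly \<open>i\<close> of the \<open>n\<close> sample values exceed
  \<open>b\<close>. So the gaps are the occupation times of the decreasing process \<open>Z\<^sub>0 = n, Z\<^sub>1, Z\<^sub>2, \<dots>\<close> that counts
  the sample values above each \<open>b\<close>; by the stick-breaking form of \<open>P\<^sub>\<bullet>\<close> and the i.i.d. factors this is a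
  Markov chain with transition probabilities \<open>p(m, k) = binom(m, k) E[H\<^sup>m\<^sup>-\<^sup>k (1 - H)\<^sup>k]\<close>. A vector of gaps
  is the same thing as a multiset of sample values (\<open>gaps_eq_iff_mset\<close>), which in turn determines the
  path of \<open>Z\<close>. Counting the arrangements of the multiset therefore gives the joint law of the gaps as
  an explicit product of mixed moments \<open>E[H\<^sup>k (1 - H)\<^sup>l]\<close> (\<open>prob_gaps\<close>).

  If \<open>H\<close> has the beta\<open>(1, \<theta>)\<close> law, then \<open>p(m, k)\<close> is a function of \<open>m\<close> times a function of \<open>k\<close>.
  Along a path from \<open>n\<close> to \<open>0\<close> these factors regroup by visited state, so the joint law of the gaps is
  a product over the states, and the gap \<open>G\<^sub>i\<close> is geometric with parameter \<open>i / (i + \<theta>)\<close>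
  (\<open>prob_gaps_beta1\<close>).

  Conversely, let the gaps of a sample of size \<open>n\<close> be independent and \<open>1 < j < n\<close>. Comparing the
  probabilities of the four gap vectors with \<open>G\<^sub>j, G\<^sub>1 \<in> {0, 1}\<close> and zeros elsewhere gives
  \<open>p(j, 1) / p(j, 0) = p(n, 1) / p(n, 0)\<close> (\<open>moment_identity_if_indep\<close>). Independence for all large \<open>n\<close>
  makes this ratio a constant \<open>\<theta> > 0\<close> for all \<open>j \<ge> 2\<close>, that is \<open>j (m\<^sub>j\<^sub>-\<^sub>1 - m\<^sub>j) = \<theta> m\<^sub>j\<close> for the moments
  \<open>m\<^sub>j = E[H\<^sup>j]\<close>. The recursion starts at \<open>j = 2\<close>, so it identifies \<open>m\<^sub>1, m\<^sub>2, \<dots>\<close> with the beta moments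
  only up to a common factor, as would be the case if \<open>H\<close> had an additional atom at \<open>0\<close>. Since \<open>H > 0\<close>,
  the factor is \<open>1\<close>, and a law on \<open>(0, 1)\<close> is determined by its moments (\<open>eq_beta1I\<close>).
\<close>

section \<open>Gaps and the multiset of sample values\<close>

text \<open>The \<open>k\<close>-th smallest of \<open>n\<close> sample values with gaps \<open>g\<close>. The convention that position \<open>0\<close>
  has the value \<open>1\<close> makes the last gap \<open>g n\<close> an ordinary increment.\<close>

definition pos_of_gaps :: "nat \<Rightarrow> (nat \<Rightarrow> nat) \<Rightarrow> nat \<Rightarrow> nat" where
  "pos_of_gaps n g k = 1 + (\<Sum>i\<in>{n + 1 - k..n}. g i)"

lemma pos_of_gaps_0 [simp]: "pos_of_gaps n g 0 = 1"
  by (simp add: pos_of_gaps_def)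

lemma pos_of_gaps_Suc:
  assumes "k < n"
  shows "pos_of_gaps n g (Suc k) = pos_of_gaps n g k + g (n - k)"
proof -
  have "{n + 1 - Suc k..n} = insert (n - k) {n + 1 - k..n}" using assms by auto
  moreover have "n - k \<notin> {n + 1 - k..n}" using assms by auto
  ultimately show ?thesis by (simp add: pos_of_gaps_def)
qed

lemma pos_of_gaps_mono: "k \<le> l \<Longrightarrow> pos_of_gaps n g k \<le> pos_of_gaps n g l"
  unfolding pos_of_gaps_def by (intro add_left_mono sum_mono2) auto

lemma pos_of_gaps_ge_1: "1 \<le> pos_of_gaps n g k"
  by (simp add: pos_of_gaps_def)

definition mset_of_gaps :: "nat \<Rightarrow> (nat \<Rightarrow> nat) \<Rightarrow> nat multiset" where
  "mset_of_gaps n g = mset (map (pos_of_gaps n g) [1..<Suc n])"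

lemma sorted_map_pos_of_gaps: "sorted (map (pos_of_gaps n g) [1..<Suc n])"
  by (auto simp: sorted_iff_nth_mono simp del: upt_Suc intro: pos_of_gaps_mono)

text \<open>The gaps are the successive differences of the sorted sample, counted from \<open>1\<close>, so both sides
  say what the sorted sample is.\<close>

lemma gaps_eq_iff_mset:
  fixes x :: "nat \<Rightarrow> nat"
  assumes x: "\<And>j. j \<in> {1..n} \<Longrightarrow> 1 \<le> x j"
  shows "(\<forall>i\<in>{1..n}. gap x n i = g i) \<longleftrightarrow> mset (map x [1..<Suc n]) = mset_of_gaps n g"
proof
  let ?s = "sort (map x [1..<Suc n])"
  assume gap: "\<forall>i\<in>{1..n}. gap x n i = g i"
  have len: "length ?s = n" by simp
  have sge: "1 \<le> ?s ! k" if "k < n" for k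
  proof -
    have "?s ! k \<in> set ?s" using that by (intro nth_mem) simp
    then show ?thesis using x by (auto simp del: upt_Suc)
  qed
  have s: "?s ! k = pos_of_gaps n g (Suc k)" if "k < n" for k
    using that
  proof (induction k)
    case 0
    then have "gap x n n = g n" using gap by auto
    then have "?s ! 0 - 1 = g n" by (simp add: gap_def order_stat_def del: upt_Suc)
    then show ?case using sge[OF 0] pos_of_gaps_Suc[OF 0, of g] by simp
  next
    case (Suc k)
    have "gap x n (n - Suc k) = g (n - Suc k)" using gap Suc.prems by auto
    moreover have "n + 1 - (n - Suc k) - 1 = Suc k" "n - (n - Suc k) - 1 = k" "n - Suc k \<noteq> n"
      using Suc.prems by auto
    ultimately have "?s ! Suc k - ?s ! k = g (n - Suc k)"
      by (simp only: gap_def order_stat_def if_False)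
    moreover have "?s ! k \<le> ?s ! Suc k" using Suc.prems by (intro sorted_nth_mono) auto
    ultimately show ?case using Suc pos_of_gaps_Suc[OF Suc.prems, of g] by simp
  qed
  have "?s = map (pos_of_gaps n g) [1..<Suc n]"
    using s by (intro nth_equalityI) (auto simp del: upt_Suc One_nat_def simp flip: Suc_eq_plus1_left)
  then show "mset (map x [1..<Suc n]) = mset_of_gaps n g"
    unfolding mset_of_gaps_def by (metis mset_sort)
next
  assume "mset (map x [1..<Suc n]) = mset_of_gaps n g"
  then have s: "sort (map x [1..<Suc n]) = map (pos_of_gaps n g) [1..<Suc n]"
    unfolding mset_of_gaps_def
    by (intro properties_for_sort sorted_map_pos_of_gaps) simp
  have os: "order_stat x n k = pos_of_gaps n g k" if "1 \<le> k" "k \<le> n" for k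
    using that unfolding order_stat_def s by (simp del: upt_Suc)
  show "\<forall>i\<in>{1..n}. gap x n i = g i"
  proof
    fix i assume i: "i \<in> {1..n}"
    show "gap x n i = g i"
    proof (cases "i = n")
      case True
      then show ?thesis using i os[of 1] pos_of_gaps_Suc[of 0 n g] by (simp add: gap_def)
    next
      case False
      then have "pos_of_gaps n g (Suc (n - i)) = pos_of_gaps n g (n - i) + g (n - (n - i))"
        using i by (intro pos_of_gaps_Suc) auto
      moreover have "1 \<le> n - i" "Suc (n - i) \<le> n" using i False by auto
      ultimately show ?thesis using i False os[of "n - i"] os[of "Suc (n - i)"]
        by (simp add: gap_def Suc_diff_le)
    qed
  qed
qed

lemma size_mset_of_gaps [simp]: "size (mset_of_gaps n g) = n"
  by (simp add: mset_of_gaps_def)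

definition num_above :: "nat multiset \<Rightarrow> nat \<Rightarrow> nat" where
  "num_above A b = size {#x \<in># A. b < x#}"

lemma num_above_empty: "num_above {#} b = 0"
  by (simp add: num_above_def)

lemma num_above_add_mset: "num_above (add_mset a A) b = (if b < a then 1 else 0) + num_above A b"
  by (simp add: num_above_def)

lemma num_above_union: "num_above (A + B) b = num_above A b + num_above B b"
  by (simp add: num_above_def)

lemma num_above_replicate_mset: "num_above (replicate_mset m x) b = (if b < x then m else 0)"
  by (induction m) (simp_all add: num_above_def)

text \<open>One step of the chain: of the values above \<open>b - 1\<close>, those equal to \<open>b\<close> drop out.\<close>

lemma count_plus_num_above:
  assumes "1 \<le> b"
  shows "count A b + num_above A b = num_above A (b - 1)"
  using assms by (induction A) (auto simp: num_above_def)

text \<open>For \<open>b\<close> between the \<open>k\<close>-th and the next position (the last position has no successor), exactly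
  the positions after the \<open>k\<close>-th lie above \<open>b\<close>.\<close>

lemma num_above_mset_of_gaps:
  assumes "k \<le> n" "pos_of_gaps n g k \<le> b" "k < n \<Longrightarrow> b < pos_of_gaps n g (Suc k)"
  shows "num_above (mset_of_gaps n g) b = n - k"
proof -
  have "num_above (mset_of_gaps n g) b
      = length (filter (\<lambda>j. b < pos_of_gaps n g j) [1..<Suc n])"
    unfolding num_above_def mset_of_gaps_def mset_filter[symmetric] size_mset
    by (simp add: filter_map o_def del: upt_Suc mset_upt)
  also have "\<dots> = card {j \<in> {1..n}. b < pos_of_gaps n g j}"
    by (subst distinct_card[symmetric]) (auto intro!: arg_cong[where f = card] simp del: upt_Suc)
  also have "{j \<in> {1..n}. b < pos_of_gaps n g j} = {Suc k..n}"
  proof (intro set_eqI iffI)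
    fix j assume j: "j \<in> {j \<in> {1..n}. b < pos_of_gaps n g j}"
    then show "j \<in> {Suc k..n}" using pos_of_gaps_mono[of j k n g] assms(2)
      by (auto simp: not_less_eq_eq) (metis le_trans not_less not_less_eq_eq)
  next
    fix j assume j: "j \<in> {Suc k..n}"
    then have "b < pos_of_gaps n g (Suc k)" using assms by auto
    also have "\<dots> \<le> pos_of_gaps n g j" using j by (intro pos_of_gaps_mono) auto
    finally show "j \<in> {j \<in> {1..n}. b < pos_of_gaps n g j}" using j by auto
  qed
  finally show ?thesis by simp
qed

text \<open>The number of values above \<open>b\<close> equals \<open>i\<close> for exactly \<open>g i\<close> places \<open>b\<close>: gaps are occupation
  times.\<close>

lemma prod_num_above_eq_prod_gaps:
  fixes q :: "nat \<Rightarrow> 'b::comm_monoid_mult"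
  assumes "q 0 = 1"
  shows "(\<Prod>b\<in>{1..pos_of_gaps n g n}. q (num_above (mset_of_gaps n g) b)) = (\<Prod>i\<in>{1..n}. q i ^ g i)"
proof -
  let ?Z = "num_above (mset_of_gaps n g)"
  \<comment> \<open>The places before the \<open>k\<close>-th position account for the \<open>k\<close> gaps of highest index.\<close>
  have "(\<Prod>b\<in>{1..<pos_of_gaps n g k}. q (?Z b)) = (\<Prod>i\<in>{n + 1 - k..n}. q i ^ g i)" if "k \<le> n" for k
    using that
  proof (induction k)
    case 0
    then show ?case by simp
  next
    case (Suc k)
    let ?a = "pos_of_gaps n g k" and ?c = "pos_of_gaps n g (Suc k)"
    have "{1..<?c} = {1..<?a} \<union> {?a..<?c}"
      using pos_of_gaps_ge_1[of n g k] pos_of_gaps_mono[of k "Suc k" n g] by auto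
    then have "(\<Prod>b\<in>{1..<?c}. q (?Z b)) = (\<Prod>b\<in>{1..<?a}. q (?Z b)) * (\<Prod>b\<in>{?a..<?c}. q (?Z b))"
      by (simp add: prod.union_disjoint)
    also have "(\<Prod>b\<in>{?a..<?c}. q (?Z b)) = (\<Prod>b\<in>{?a..<?c}. q (n - k))"
      using Suc.prems by (intro prod.cong refl) (simp add: num_above_mset_of_gaps[of k])
    also have "\<dots> = q (n - k) ^ g (n - k)" using pos_of_gaps_Suc[of k n g] Suc.prems by simp
    finally have "(\<Prod>b\<in>{1..<?c}. q (?Z b)) = q (n - k) ^ g (n - k) * (\<Prod>i\<in>{n + 1 - k..n}. q i ^ g i)"
      using Suc by (simp add: mult.commute)
    moreover have "{n + 1 - Suc k..n} = insert (n - k) {n + 1 - k..n}" using Suc.prems by auto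
    moreover have "n - k \<notin> {n + 1 - k..n}" using Suc.prems by auto
    ultimately show ?case by simp
  qed
  from this[of n] have main: "(\<Prod>b\<in>{1..<pos_of_gaps n g n}. q (?Z b)) = (\<Prod>i\<in>{1..n}. q i ^ g i)" by simp
  have "{1..pos_of_gaps n g n} = insert (pos_of_gaps n g n) {1..<pos_of_gaps n g n}"
    using pos_of_gaps_ge_1[of n g n] by auto
  then show ?thesis using main assms num_above_mset_of_gaps[of n n g "pos_of_gaps n g n"] by simp
qed

section \<open>Joint law of the gaps\<close>

lemma prod_mset_mset_conv_nth: "(\<Prod>b\<in>#mset l. f b) = (\<Prod>i\<in>{0..<length l}. f (l ! i))"
  by (induction l) (simp_all add: prod.atLeast0_lessThan_Suc_shift del: prod.op_ivl_Suc)

locale iid_residual_sample = prob_space M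
  for M :: "'a measure" +
  fixes H :: "nat \<Rightarrow> 'a \<Rightarrow> real" and X :: "nat \<Rightarrow> 'a \<Rightarrow> nat"
  assumes factors: "iid_factors M H"
    and sample: "iid_sample_from M (residual_allocation H) X"
begin

abbreviation P :: "nat \<Rightarrow> 'a \<Rightarrow> real" where "P \<equiv> residual_allocation H"

lemma H_indep: "indep_vars (\<lambda>_. borel) H {1..}"
  using factors unfolding iid_factors_def by (rule conjunct1)

lemma H_meas [measurable]: "1 \<le> i \<Longrightarrow> H i \<in> borel_measurable M"
  using H_indep by (auto simp: indep_vars_def)

lemma H_range: "1 \<le> i \<Longrightarrow> w \<in> space M \<Longrightarrow> 0 < H i w \<and> H i w < 1"
  using factors unfolding iid_factors_def greaterThanLessThan_iff by blast

lemma H_distr: "1 \<le> i \<Longrightarrow> distr M borel (H i) = distr M borel (H 1)"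
  using factors unfolding iid_factors_def by blast

lemma X_meas: "1 \<le> j \<Longrightarrow> X j \<in> measurable M (count_space {1..})"
  using sample unfolding iid_sample_from_def cond_indep_vars_def by blast

lemma X_ge_1: "1 \<le> j \<Longrightarrow> w \<in> space M \<Longrightarrow> 1 \<le> X j w"
  using measurable_space[OF X_meas[of j]] by auto

lemma X_meas_UNIV: "1 \<le> j \<Longrightarrow> X j \<in> measurable M (count_space UNIV)"
  using X_meas[of j] measurable_compose[OF X_meas[of j], of "\<lambda>x. x" "count_space UNIV"] by simp

lemma X_event: "1 \<le> j \<Longrightarrow> {w \<in> space M. X j w = b} \<in> sets M"
  using measurable_sets[OF X_meas_UNIV, of j "{b}"] by (simp add: vimage_def Int_def conj_commute)

lemma finite_measure_subalgebra_sigma_seq: "finite_measure_subalgebra M (sigma_seq M P)"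
proof unfold_locales
  have "(\<lambda>w. \<lambda>j\<in>{1..}. P j w) \<in> measurable M (Pi\<^sub>M {1..} (\<lambda>_. borel))"
    using sample by (intro measurable_restrict) (auto simp: iid_sample_from_def)
  then have "sets (sigma_seq M P) \<subseteq> sets M"
    unfolding sigma_seq_def by (rule sets_image_in_sets[OF refl])
  moreover have "space (sigma_seq M P) = space M" by (simp only: sigma_seq_def space_vimage_algebra)
  ultimately show "subalgebra M (sigma_seq M P)" by (simp only: subalgebra_def simp_thms)
qed

text \<open>Conditional independence gives the conditional probability of the list as the product of the
  \<open>P b\<close>; its expectation is the probability.\<close>

lemma prob_sample_eq_list:
  assumes l: "length l = n" "set l \<subseteq> {1..}"
  shows "prob {w \<in> space M. map (\<lambda>j. X j w) [1..<Suc n] = l} = (\<integral>w. (\<Prod>b\<in>#mset l. P b w) \<partial>M)"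
proof -
  let ?F = "sigma_seq M P"
  interpret S: finite_measure_subalgebra M ?F by (rule finite_measure_subalgebra_sigma_seq)
  define A where "A j = {l ! (j - 1)}" for j
  define E where "E = {v \<in> space M. \<forall>j\<in>{1..n}. X j v \<in> A j}"
  have mem: "l ! (j - 1) \<in> {1..}" if "j \<in> {1..n}" for j
    using l that nth_mem[of "j - 1" l] by fastforce
  have E_meas: "E \<in> sets M"
    unfolding E_def A_def by (intro sets.sets_Collect_finite_All) (auto intro: X_event)
  have E: "{w \<in> space M. map (\<lambda>j. X j w) [1..<Suc n] = l} = E"
  proof -
    have "map x [1..<Suc n] = l \<longleftrightarrow> (\<forall>j\<in>{1..n}. x j \<in> A j)" for x :: "nat \<Rightarrow> nat"
    proof
      assume "map x [1..<Suc n] = l"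
      then have "l ! (j - 1) = x j" if "j \<in> {1..n}" for j using that by (auto simp del: upt_Suc)
      then show "\<forall>j\<in>{1..n}. x j \<in> A j" by (auto simp: A_def)
    next
      assume a: "\<forall>j\<in>{1..n}. x j \<in> A j"
      show "map x [1..<Suc n] = l"
      proof (rule nth_equalityI)
        fix i assume "i < length (map x [1..<Suc n])"
        then show "map x [1..<Suc n] ! i = l ! i"
          using bspec[OF a, of "Suc i"] by (auto simp: A_def simp del: upt_Suc)
      qed (use l in simp)
    qed
    then show ?thesis by (simp add: E_def)
  qed
  have "AE w in M. cond_prob_given M ?F E w
      = (\<Prod>j\<in>{1..n}. cond_prob_given M ?F {v \<in> space M. X j v \<in> A j} w)"
  proof -
    have "cond_indep_vars M ?F (\<lambda>_. count_space {1..}) X {1..}"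
      using sample by (simp only: iid_sample_from_def)
    then have "(\<forall>J A. J \<subseteq> {1..} \<and> finite J \<and> (\<forall>j\<in>J. A j \<in> sets (count_space {1..})) \<longrightarrow>
        (AE w in M. cond_prob_given M ?F {v \<in> space M. \<forall>j\<in>J. X j v \<in> A j} w
                  = (\<Prod>j\<in>J. cond_prob_given M ?F {v \<in> space M. X j v \<in> A j} w)))"
      unfolding cond_indep_vars_def by (rule conjunct2)
    from this[rule_format, of "{1..n}" A] show ?thesis
      using mem unfolding E_def by (auto simp: A_def)
  qed
  moreover have "AE w in M. \<forall>j\<in>{1..n}.
      cond_prob_given M ?F {v \<in> space M. X j v \<in> A j} w = P (l ! (j - 1)) w"
  proof (rule AE_finite_allI)
    fix j assume j: "j \<in> {1..n}"
    have "{v \<in> space M. X j v \<in> A j} = {v \<in> space M. X j v = l ! (j - 1)}" by (simp add: A_def)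
    moreover have "1 \<le> j" "1 \<le> l ! (j - 1)" using j mem[OF j] by auto
    ultimately show "AE w in M. cond_prob_given M ?F {v \<in> space M. X j v \<in> A j} w = P (l ! (j - 1)) w"
      using sample by (simp only: iid_sample_from_def)
  qed simp
  ultimately have ae: "AE w in M. cond_prob_given M ?F E w = (\<Prod>b\<in>#mset l. P b w)"
  proof eventually_elim
    case (elim w)
    then have "cond_prob_given M ?F E w = (\<Prod>j\<in>{1..n}. P (l ! (j - 1)) w)" by simp
    also have "\<dots> = (\<Prod>i\<in>{0..<n}. P (l ! i) w)"
      by (rule prod.reindex_bij_witness[of _ Suc "\<lambda>j. j - 1"]) auto
    also have "\<dots> = (\<Prod>b\<in>#mset l. P b w)"
      using l by (simp only: prod_mset_mset_conv_nth)
    finally show ?case .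
  qed
  have P_meas: "P b \<in> borel_measurable M" if "b \<in> set l" for b
    using sample l that by (auto simp: iid_sample_from_def)
  have int: "integrable M (indicator E :: 'a \<Rightarrow> real)"
    using E_meas by (simp add: emeasure_eq_measure)
  have "prob E = (\<integral>w. indicator E w \<partial>M)" using E_meas by simp
  also have "\<dots> = (\<integral>w. cond_prob_given M ?F E w \<partial>M)"
    unfolding cond_prob_given_def using S.real_cond_exp_int(2)[OF int] by simp
  also have "\<dots> = (\<integral>w. (\<Prod>b\<in>#mset l. P b w) \<partial>M)"
  proof (rule integral_cong_AE[OF _ _ ae])
    show "cond_prob_given M ?F E \<in> borel_measurable M"
      unfolding cond_prob_given_def using S.real_cond_exp_int(1)[OF int] by (rule borel_measurable_integrable)
    have "(\<lambda>w. \<Prod>i\<in>{0..<n}. P (l ! i) w) \<in> borel_measurable M"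
      using P_meas l by (intro borel_measurable_prod) auto
    then show "(\<lambda>w. \<Prod>b\<in>#mset l. P b w) \<in> borel_measurable M"
      using l by (simp only: prod_mset_mset_conv_nth)
  qed
  finally show ?thesis unfolding E .
qed

definition factor_moment :: "nat \<Rightarrow> nat \<Rightarrow> real" where
  "factor_moment k l = (\<integral>w. H 1 w ^ k * (1 - H 1 w) ^ l \<partial>M)"

lemma factor_moment_eq:
  assumes "1 \<le> i"
  shows "(\<integral>w. H i w ^ k * (1 - H i w) ^ l \<partial>M) = factor_moment k l"
proof -
  have "(\<integral>w. H i w ^ k * (1 - H i w) ^ l \<partial>M) = (\<integral>x. x ^ k * (1 - x) ^ l \<partial>distr M borel (H i))"
    using assms by (subst integral_distr) auto
  also have "\<dots> = (\<integral>x. x ^ k * (1 - x) ^ l \<partial>distr M borel (H 1))" by (simp only: H_distr[OF assms])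
  also have "\<dots> = factor_moment k l" unfolding factor_moment_def by (subst integral_distr) auto
  finally show ?thesis .
qed

lemma integrable_factor_moment:
  assumes "1 \<le> i"
  shows "integrable M (\<lambda>w. H i w ^ k * (1 - H i w) ^ l)"
proof (rule integrable_const_bound[of _ 1])
  show "AE w in M. norm (H i w ^ k * (1 - H i w) ^ l) \<le> 1"
    using H_range[OF assms]
    by (intro AE_I2) (simp add: abs_mult power_abs mult_le_one power_le_one less_imp_le)
qed (use assms in measurable)

text \<open>A sample value \<open>b\<close> contributes \<open>H b\<close> and the factors \<open>1 - H i\<close> with \<open>i < b\<close>. Collected by \<open>i\<close>, the
  exponent of \<open>1 - H i\<close> is the number of values above \<open>i\<close>.\<close>

lemma prod_mset_P:
  assumes "set_mset A \<subseteq> {1..T}"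
  shows "(\<Prod>b\<in>#A. P b w) = (\<Prod>i\<in>{1..T}. H i w ^ count A i * (1 - H i w) ^ num_above A i)"
  using assms
proof (induction A)
  case empty
  then show ?case by (simp add: num_above_def)
next
  case (add b A)
  have b: "b \<in> {1..T}" using add.prems by auto
  have "(\<Prod>i\<in>{1..T}. H i w ^ count (add_mset b A) i * (1 - H i w) ^ num_above (add_mset b A) i)
      = (\<Prod>i\<in>{1..T}. (if i = b then H i w else 1) * (if i \<in> {1..<b} then 1 - H i w else 1)
            * (H i w ^ count A i * (1 - H i w) ^ num_above A i))"
    by (intro prod.cong refl) (auto simp: num_above_add_mset)
  also have "\<dots> = (\<Prod>i\<in>{1..T}. if i = b then H i w else 1) * (\<Prod>i\<in>{1..T}. if i \<in> {1..<b} then 1 - H i w else 1)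
      * (\<Prod>b\<in>#A. P b w)"
    using add by (simp add: prod.distrib)
  also have "(\<Prod>i\<in>{1..T}. if i = b then H i w else 1) = H b w" using b by (simp add: prod.delta)
  also have "(\<Prod>i\<in>{1..T}. if i \<in> {1..<b} then 1 - H i w else 1) = (\<Prod>i\<in>{1..<b}. 1 - H i w)"
    using b by (intro prod.mono_neutral_cong_right) auto
  finally show ?case by (simp add: residual_allocation_def)
qed

lemma integral_prod_mset_P:
  assumes "set_mset A \<subseteq> {1..T}"
  shows "(\<integral>w. (\<Prod>b\<in>#A. P b w) \<partial>M) = (\<Prod>i\<in>{1..T}. factor_moment (count A i) (num_above A i))"
proof -
  have "indep_vars (\<lambda>_. borel) (\<lambda>i w. (H i w) ^ count A i * (1 - H i w) ^ num_above A i) {1..T}"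
    by (rule indep_vars_compose2[OF indep_vars_subset[OF H_indep], where Y = "\<lambda>i x. x ^ count A i * (1 - x) ^ num_above A i"]) auto
  then have "(\<integral>w. (\<Prod>i\<in>{1..T}. H i w ^ count A i * (1 - H i w) ^ num_above A i) \<partial>M)
      = (\<Prod>i\<in>{1..T}. \<integral>w. H i w ^ count A i * (1 - H i w) ^ num_above A i \<partial>M)"
    by (intro indep_vars_lebesgue_integral integrable_factor_moment) auto
  also have "\<dots> = (\<Prod>i\<in>{1..T}. factor_moment (count A i) (num_above A i))"
    by (intro prod.cong refl factor_moment_eq) auto
  finally show ?thesis using prod_mset_P[OF assms] by simp
qed

lemma sample_list_event: "{w \<in> space M. map (\<lambda>j. X j w) [1..<Suc n] = l} \<in> sets M"
proof (cases "length l = n")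
  case True
  then have "{w \<in> space M. map (\<lambda>j. X j w) [1..<Suc n] = l} = {w \<in> space M. \<forall>j\<in>{..<n}. X (Suc j) w = l ! j}"
    by (auto simp: list_eq_iff_nth_eq simp del: upt_Suc)
  also have "\<dots> \<in> sets M" by (intro sets.sets_Collect_finite_All X_event) auto
  finally show ?thesis .
next
  case False
  then have "{w \<in> space M. map (\<lambda>j. X j w) [1..<Suc n] = l} = {}" by (auto simp del: upt_Suc)
  then show ?thesis by (simp only: sets.empty_sets)
qed

text \<open>All arrangements of \<open>A\<close> are equally likely, and their number is a multinomial coefficient.\<close>

lemma prob_sample_mset:
  assumes A: "size A = n" "set_mset A \<subseteq> {1..T}"
  shows "prob {w \<in> space M. mset (map (\<lambda>j. X j w) [1..<Suc n]) = A}
      = fact n * (\<Prod>i\<in>{1..T}. factor_moment (count A i) (num_above A i) / fact (count A i))"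
proof -
  let ?L = "\<lambda>w. map (\<lambda>j. X j w) [1..<Suc n]"
  define I where "I = (\<Prod>i\<in>{1..T}. factor_moment (count A i) (num_above A i))"
  have l: "length l = n" "set l \<subseteq> {1..}" "mset l = A" if "l \<in> permutations_of_multiset A" for l
    using that A by (auto simp: permutations_of_multiset_def)
  have "{w \<in> space M. mset (?L w) = A} = (\<Union>l\<in>permutations_of_multiset A. {w \<in> space M. ?L w = l})"
    by (auto simp: permutations_of_multiset_def)
  then have "prob {w \<in> space M. mset (?L w) = A}
      = (\<Sum>l\<in>permutations_of_multiset A. prob {w \<in> space M. ?L w = l})"
    using sample_list_event by (simp only:) (intro finite_measure_finite_Union, auto simp: disjoint_family_on_def simp del: upt_Suc)
  also have "\<dots> = (\<Sum>l\<in>permutations_of_multiset A. I)"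
    using l A(2) by (intro sum.cong refl) (simp add: prob_sample_eq_list integral_prod_mset_P I_def del: upt_Suc One_nat_def)
  also have "\<dots> = card (permutations_of_multiset A) * I" by simp
  also have "(\<Prod>x\<in>set_mset A. fact (count A x)) = (\<Prod>i\<in>{1..T}. fact (count A i) :: nat)"
    using A(2) by (intro prod.mono_neutral_left) (auto simp: not_in_iff)
  then have "card (permutations_of_multiset A) * (\<Prod>i\<in>{1..T}. fact (count A i)) = fact n"
    using card_permutations_of_multiset_aux[of A] A(1) by simp
  then have "real (card (permutations_of_multiset A)) * (\<Prod>i\<in>{1..T}. fact (count A i)) = fact n"
    by (metis (mono_tags, lifting) of_nat_fact of_nat_mult of_nat_prod prod.cong)
  then have "real (card (permutations_of_multiset A)) = fact n / (\<Prod>i\<in>{1..T}. fact (count A i))"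
    by (simp add: field_simps)
  finally show ?thesis by (simp add: I_def prod_dividef)
qed

text \<open>Here \<open>T\<close> can be any bound of the sample values that \<open>g\<close> encodes: a place above all of them
  contributes the moment \<open>E[1] = 1\<close>.\<close>

lemma prob_gaps:
  assumes "pos_of_gaps n g n \<le> T"
  shows "prob {w \<in> space M. \<forall>i\<in>{1..n}. gap (\<lambda>j. X j w) n i = g i}
      = fact n * (\<Prod>b\<in>{1..T}.
          factor_moment (count (mset_of_gaps n g) b) (num_above (mset_of_gaps n g) b) / fact (count (mset_of_gaps n g) b))"
proof -
  have "{w \<in> space M. \<forall>i\<in>{1..n}. gap (\<lambda>j. X j w) n i = g i}
      = {w \<in> space M. mset (map (\<lambda>j. X j w) [1..<Suc n]) = mset_of_gaps n g}"
    using X_ge_1 by (intro Collect_cong conj_cong refl gaps_eq_iff_mset) auto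
  moreover have "set_mset (mset_of_gaps n g) \<subseteq> {1..T}"
    using pos_of_gaps_ge_1 order_trans[OF pos_of_gaps_mono assms]
    by (auto simp: mset_of_gaps_def simp del: upt_Suc One_nat_def)
  ultimately show ?thesis by (simp only: prob_sample_mset[OF size_mset_of_gaps])
qed

lemma gap_meas: "i \<in> {1..n} \<Longrightarrow> (\<lambda>w. gap (\<lambda>j. X j w) n i) \<in> measurable M (count_space UNIV)"
proof -
  have "(\<lambda>w. map (\<lambda>j. X j w) [1..<Suc n]) \<in> measurable M (count_space UNIV)"
    unfolding measurable_count_space_eq2_countable using sample_list_event
    by (auto simp: vimage_def Int_def conj_commute simp del: upt_Suc)
  from measurable_compose[OF this, of "\<lambda>l. if i = n then sort l ! (1 - 1) - 1
      else sort l ! (n + 1 - i - 1) - sort l ! (n - i - 1)" "count_space UNIV"]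
  show ?thesis unfolding gap_def order_stat_def by (simp only: measurable_count_space)
qed

end

section \<open>Distributions on the open unit interval\<close>

lemma Gamma_plus1_pos: "0 < x \<Longrightarrow> Gamma (x + 1) = x * Gamma x" for x :: real
  using Gamma_plus1[of x] nonpos_Ints_nonpos[of x] by force

lemma Gamma_nonzero_pos: "0 < x \<Longrightarrow> Gamma x \<noteq> 0" for x :: real
  using Gamma_real_pos[of x] by linarith

text \<open>Laws on \<open>(0, 1)\<close>, as measures on the real line: this is where characteristic functions are
  available.\<close>

locale open_unit_distribution = real_distribution M for M :: "real measure" +
  assumes AE_open_unit: "AE x in M. 0 < x \<and> x < 1"
begin

definition mixed_moment :: "nat \<Rightarrow> nat \<Rightarrow> real" where
  "mixed_moment k l = (\<integral>x. x ^ k * (1 - x) ^ l \<partial>M)"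

lemma integrable_mixed: "integrable M (\<lambda>x. x ^ k * (1 - x) ^ l)"
proof (rule integrable_const_bound[of _ 1])
  show "AE x in M. norm (x ^ k * (1 - x) ^ l) \<le> 1"
    using AE_open_unit by eventually_elim (simp add: abs_mult power_abs mult_le_one power_le_one less_imp_le)
qed simp

lemma integrable_power: "integrable M (\<lambda>x. x ^ k)"
  using integrable_mixed[of k 0] by simp

lemma mixed_moment_Suc: "mixed_moment k (Suc l) = mixed_moment k l - mixed_moment (Suc k) l"
proof -
  have "mixed_moment k (Suc l) = (\<integral>x. x ^ k * (1 - x) ^ l - x ^ Suc k * (1 - x) ^ l \<partial>M)"
    unfolding mixed_moment_def by (intro Bochner_Integration.integral_cong) (auto simp: algebra_simps)
  then show ?thesis
    unfolding mixed_moment_def by (subst (asm) Bochner_Integration.integral_diff) (rule integrable_mixed)+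
qed

lemma mixed_moment_0_0: "mixed_moment 0 0 = 1"
  using prob_space by (simp add: mixed_moment_def)

lemma mixed_moment_nonneg: "0 \<le> mixed_moment k l"
  unfolding mixed_moment_def
proof (rule integral_nonneg_AE)
  show "AE x in M. 0 \<le> x ^ k * (1 - x) ^ l"
    using AE_open_unit by eventually_elim simp
qed

lemma mixed_moment_pos: "0 < mixed_moment k l"
proof (rule ccontr)
  assume "\<not> 0 < mixed_moment k l"
  then have "(\<integral>x. x ^ k * (1 - x) ^ l \<partial>M) = 0"
    using mixed_moment_nonneg[of k l] by (simp add: mixed_moment_def)
  moreover have "AE x in M. 0 \<le> x ^ k * (1 - x) ^ l"
    using AE_open_unit by eventually_elim auto
  ultimately have "AE x in M. x ^ k * (1 - x) ^ l = 0"
    using integral_nonneg_eq_0_iff_AE[OF integrable_mixed] by blast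
  with AE_open_unit have "AE x in M. False"
    by eventually_elim auto
  then show False by simp
qed

text \<open>The geometric series \<open>\<Sum>\<^sub>i x (1 - x)\<^sup>i = 1\<close>, integrated. It holds because \<open>0\<close> is not an atom,
  and it is what fixes the total mass in \<open>eq_beta1I\<close>.\<close>

lemma sum_mixed_moment_1: "(\<lambda>l. \<Sum>i<l. mixed_moment 1 i) \<longlonglongrightarrow> 1"
proof -
  have "(\<Sum>i<l. mixed_moment 1 i) = 1 - mixed_moment 0 l" for l
    by (induction l) (simp_all add: mixed_moment_0_0 mixed_moment_Suc)
  moreover have "(\<lambda>l. mixed_moment 0 l) \<longlonglongrightarrow> (\<integral>x. 0 \<partial>M)"
    unfolding mixed_moment_def
  proof (rule integral_dominated_convergence[where w = "\<lambda>_. 1"])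
    show "AE x in M. (\<lambda>l. x ^ 0 * (1 - x) ^ l) \<longlonglongrightarrow> 0"
      using AE_open_unit by eventually_elim (auto intro!: LIMSEQ_power_zero)
    show "AE x in M. norm (x ^ 0 * (1 - x) ^ l) \<le> 1" for l
      using AE_open_unit by eventually_elim (simp add: abs_mult power_abs mult_le_one power_le_one less_imp_le)
  qed auto
  ultimately show ?thesis using tendsto_diff[OF tendsto_const[of "1::real"], of "\<lambda>l. mixed_moment 0 l" 0] by simp
qed

end

text \<open>Moments of a law on the unit interval are bounded by \<open>1\<close>, so the Taylor series of the characteristic
  function converges to it, and that series depends on the moments only.\<close>

lemma open_unit_distribution_eqI:
  assumes M: "open_unit_distribution M" and N: "open_unit_distribution N"
    and eq: "\<And>k. (\<integral>x. x ^ k \<partial>M) = (\<integral>x. x ^ k \<partial>N)"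
  shows "M = N"
proof -
  interpret M: open_unit_distribution M by (rule M)
  interpret N: open_unit_distribution N by (rule N)
  have "char M t = char N t" for t
  proof -
    define S where "S n = (\<Sum>k\<le>n. ((\<i> * t) ^ k / fact k) * complex_of_real (\<integral>x. x ^ k \<partial>M))" for n
    have le: "cmod (char L t - S n) \<le> 2 * (\<bar>t\<bar> ^ n / fact n)"
      if "open_unit_distribution L" "\<And>k. (\<integral>x. x ^ k \<partial>M) = (\<integral>x. x ^ k \<partial>L)" for L n
    proof -
      interpret L: open_unit_distribution L by (rule that)
      have "cmod (char L t - S n) \<le> (2 * \<bar>t\<bar> ^ n / fact n) * (\<integral>x. \<bar>x\<bar> ^ n \<partial>L)"
        unfolding S_def that(2) by (intro L.char_approx1 L.integrable_power)
      also have "\<dots> \<le> (2 * \<bar>t\<bar> ^ n / fact n) * 1"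
      proof (rule mult_left_mono)
        have "(\<integral>x. \<bar>x\<bar> ^ n \<partial>L) \<le> (\<integral>x. 1 \<partial>L)"
        proof (rule integral_mono_AE)
          show "integrable L (\<lambda>x. \<bar>x\<bar> ^ n)" using integrable_norm[OF L.integrable_power[of n]] by (simp add: power_abs)
          show "AE x in L. \<bar>x\<bar> ^ n \<le> 1" using L.AE_open_unit by eventually_elim (simp add: power_le_one)
        qed simp
        also have "(\<integral>x. 1 \<partial>L) = (1 :: real)" using L.prob_space by simp
        finally show "(\<integral>x. \<bar>x\<bar> ^ n \<partial>L) \<le> 1" .
      qed simp
      finally show ?thesis by simp
    qed
    have lim: "(\<lambda>n. 2 * (\<bar>t\<bar> ^ n / fact n)) \<longlonglongrightarrow> 0"
      using tendsto_mult_right[OF summable_LIMSEQ_zero[OF summable_exp[of "\<bar>t\<bar>"]], of 2]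
      by (simp add: field_simps)
    have "S \<longlonglongrightarrow> char L t"
      if "open_unit_distribution L" "\<And>k. (\<integral>x. x ^ k \<partial>M) = (\<integral>x. x ^ k \<partial>L)" for L
    proof (rule LIM_zero_cancel, rule Lim_null_comparison[OF _ lim])
      show "\<forall>\<^sub>F n in sequentially. cmod (S n - char L t) \<le> 2 * (\<bar>t\<bar> ^ n / fact n)"
        using le[OF that] by (intro always_eventually allI) (simp only: norm_minus_commute)
    qed
    from this[OF M refl] this[OF N eq] show ?thesis by (rule LIMSEQ_unique)
  qed
  then have "char M = char N" by (rule ext)
  then show ?thesis
    by (rule Levy_uniqueness[OF M.real_distribution_axioms N.real_distribution_axioms])
qed

definition beta1 :: "real \<Rightarrow> real measure" where
  "beta1 \<theta> = density lborel (\<lambda>x. ennreal (beta1_density \<theta> x))"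

lemma beta1_density_measurable [measurable]: "beta1_density \<theta> \<in> borel_measurable borel"
  unfolding beta1_density_def[abs_def] by measurable

lemma beta1_density_nonneg: "0 \<le> \<theta> \<Longrightarrow> 0 \<le> beta1_density \<theta> x"
  by (simp add: beta1_density_def)

text \<open>Euler's integral for \<open>\<theta> Beta(k + 1, l + \<theta>)\<close>.\<close>

lemma has_bochner_integral_beta1_density:
  assumes "0 < \<theta>"
  shows "has_bochner_integral lborel (\<lambda>x. beta1_density \<theta> x * (x ^ k * (1 - x) ^ l))
           (\<theta> * fact k * Gamma (real l + \<theta>) / Gamma (real k + real l + 1 + \<theta>))"
proof -
  let ?f = "\<lambda>x. beta1_density \<theta> x * (x ^ k * (1 - x) ^ l)"
  let ?I = "\<theta> * Beta (real k + 1) (real l + \<theta>)"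
  have nonneg: "0 \<le> ?f x" for x
    using assms by (auto simp: beta1_density_def)
  have "((\<lambda>t. \<theta> * (t powr (real k + 1 - 1) * (1 - t) powr (real l + \<theta> - 1))) has_integral ?I) {0<..<1}"
    unfolding has_integral_Icc_iff_Ioo[symmetric]
    using assms by (intro has_integral_mult_right has_integral_Beta_real) auto
  then have "(?f has_integral ?I) {0<..<1}"
  proof (rule has_integral_eq[rotated])
    fix t :: real assume t: "t \<in> {0<..<1}"
    have "(1 - t) powr (real l + \<theta> - 1) = (1 - t) powr (\<theta> - 1) * (1 - t) ^ l"
      using t by (subst powr_realpow[symmetric]) (simp_all add: powr_add[symmetric] algebra_simps)
    then show "\<theta> * (t powr (real k + 1 - 1) * (1 - t) powr (real l + \<theta> - 1)) = ?f t"
      using t by (simp add: beta1_density_def powr_realpow)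
  qed
  then have "(?f has_integral ?I) UNIV"
    by (rule has_integral_on_superset) (auto simp: beta1_density_def)
  then have "integral\<^sup>N lborel ?f = ?I"
    using nonneg by (intro nn_integral_has_integral_lborel) auto
  moreover have "?I = \<theta> * fact k * Gamma (real l + \<theta>) / Gamma (real k + real l + 1 + \<theta>)"
  proof -
    have "Gamma (real k + 1) = fact k" using Gamma_fact[of k, where ?'a = real] by (simp only: add.commute)
    moreover have "real k + 1 + (real l + \<theta>) = real k + real l + 1 + \<theta>" by simp
    ultimately show ?thesis by (simp only: Beta_def mult.assoc times_divide_eq_right)
  qed
  moreover have "0 \<le> ?I" using assms by (simp add: Beta_def)
  ultimately show ?thesis
    using nonneg by (intro has_bochner_integral_nn_integral) auto
qed

lemma open_unit_distribution_beta1: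
  assumes "0 < \<theta>"
  shows "open_unit_distribution (beta1 \<theta>)"
proof -
  have "emeasure (beta1 \<theta>) (space (beta1 \<theta>)) = (\<integral>\<^sup>+x. ennreal (beta1_density \<theta> x) \<partial>lborel)"
    by (simp add: beta1_def emeasure_density)
  also have "\<dots> = ennreal (\<theta> * Gamma \<theta> / Gamma (1 + \<theta>))"
    using has_bochner_integral_beta1_density[OF assms, of 0 0] beta1_density_nonneg[of \<theta>] assms
    by (subst nn_integral_eq_integral) (auto simp: has_bochner_integral_iff)
  also have "\<dots> = 1"
  proof -
    have "Gamma (1 + \<theta>) = \<theta> * Gamma \<theta>" "Gamma \<theta> \<noteq> 0"
      using Gamma_plus1_pos[OF assms] Gamma_real_pos[OF assms] by (simp_all add: add.commute)
    then show ?thesis using assms by simp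
  qed
  finally interpret prob_space "beta1 \<theta>" by (rule prob_spaceI)
  show ?thesis
  proof unfold_locales
    show "AE x in beta1 \<theta>. 0 < x \<and> x < 1"
      unfolding beta1_def by (subst AE_density) (auto simp: beta1_density_def)
  qed (simp_all add: beta1_def)
qed

lemma integral_beta1:
  assumes "0 < \<theta>"
  shows "(\<integral>x. x ^ k * (1 - x) ^ l \<partial>beta1 \<theta>)
           = \<theta> * fact k * Gamma (real l + \<theta>) / Gamma (real k + real l + 1 + \<theta>)"
  using has_bochner_integral_beta1_density[OF assms, of k l] beta1_density_nonneg[of \<theta>] assms
  unfolding beta1_def by (subst integral_real_density) (auto simp: has_bochner_integral_iff)

text \<open>The hypothesis is a recursion for the moments of \<open>M\<close> that the beta moments also satisfy, but
  it does not link the first moment to the zeroth. Hence all mixed moments with at least one factor \<open>x\<close>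
  agree with those of the beta law up to one constant \<open>a\<close>; \<open>sum_mixed_moment_1\<close>, applied to both laws,
  gives \<open>a = 1\<close>.\<close>

lemma eq_beta1I:
  assumes M: "open_unit_distribution M" and \<theta>: "0 < \<theta>"
    and rec: "\<And>j. 2 \<le> j \<Longrightarrow> real j * (\<integral>x. x ^ (j - 1) * (1 - x) \<partial>M) = \<theta> * (\<integral>x. x ^ j \<partial>M)"
  shows "M = beta1 \<theta>"
proof -
  interpret M: open_unit_distribution M by (rule M)
  interpret B: open_unit_distribution "beta1 \<theta>" using \<theta> by (rule open_unit_distribution_beta1)
  let ?m = M.mixed_moment and ?b = B.mixed_moment
  define a where "a = ?m 1 0 / ?b 1 0"
  have m_rec: "(real (Suc j) + \<theta>) * ?m (Suc j) 0 = real (Suc j) * ?m j 0" if "1 \<le> j" for j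
  proof -
    have "real (Suc j) * ?m j (Suc 0) = \<theta> * ?m (Suc j) 0"
      using rec[of "Suc j"] that by (simp add: M.mixed_moment_def)
    then show ?thesis unfolding M.mixed_moment_Suc[of j 0] by (simp add: algebra_simps)
  qed
  have b_rec: "(real (Suc j) + \<theta>) * ?b (Suc j) 0 = real (Suc j) * ?b j 0" for j
  proof -
    have "Gamma (real (Suc j) + 1 + \<theta>) = (real (Suc j) + \<theta>) * Gamma (real j + 1 + \<theta>)"
      using Gamma_plus1_pos[of "real (Suc j) + \<theta>"] \<theta> by (simp add: add_ac)
    then show ?thesis
      using integral_beta1[OF \<theta>, of j 0] integral_beta1[OF \<theta>, of "Suc j" 0] \<theta>
      by (simp add: B.mixed_moment_def)
  qed
  have power: "?m (Suc j) 0 = a * ?b (Suc j) 0" for j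
  proof (induction j)
    case 0
    show ?case using B.mixed_moment_pos[of 1 0] by (simp add: a_def)
  next
    case (Suc j)
    have "(real (Suc (Suc j)) + \<theta>) * ?m (Suc (Suc j)) 0 = (real (Suc (Suc j)) + \<theta>) * (a * ?b (Suc (Suc j)) 0)"
      using m_rec[of "Suc j"] b_rec[of "Suc j"] Suc by (simp add: mult.left_commute)
    then show ?case using \<theta> by (subst (asm) mult_left_cancel) auto
  qed
  have mixed: "?m (Suc k) l = a * ?b (Suc k) l" for k l
    by (induction l arbitrary: k) (simp_all add: power M.mixed_moment_Suc B.mixed_moment_Suc algebra_simps)
  have "(\<lambda>l. \<Sum>i<l. ?m 1 i) = (\<lambda>l. a * (\<Sum>i<l. ?b 1 i))"
    using mixed[of 0] by (simp add: sum_distrib_left)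
  then have "(\<lambda>l. a * (\<Sum>i<l. ?b 1 i)) \<longlonglongrightarrow> 1" using M.sum_mixed_moment_1 by simp
  moreover have "(\<lambda>l. a * (\<Sum>i<l. ?b 1 i)) \<longlonglongrightarrow> a * 1"
    by (intro tendsto_mult_left B.sum_mixed_moment_1)
  ultimately have a: "a = 1" by (metis LIMSEQ_unique mult_1_right)
  show ?thesis
  proof (rule open_unit_distribution_eqI[OF M B.open_unit_distribution_axioms])
    fix k
    have "?m k 0 = ?b k 0"
      by (cases k) (simp_all add: a power M.mixed_moment_0_0 B.mixed_moment_0_0)
    then show "(\<integral>x. x ^ k \<partial>M) = (\<integral>x. x ^ k \<partial>beta1 \<theta>)"
      by (simp add: M.mixed_moment_def B.mixed_moment_def)
  qed
qed

section \<open>Beta factors give independent gaps\<close>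

text \<open>The vector of the \<open>G i\<close> takes countably many values, so its law is determined by its point
  probabilities and hence is that of the coordinates of a product of probability mass functions.\<close>

lemma (in prob_space) indep_vars_if_joint_pmf_product:
  fixes G :: "'i \<Rightarrow> 'a \<Rightarrow> 'b::countable" and p :: "'i \<Rightarrow> 'b pmf"
  assumes fin: "finite I"
    and meas: "\<And>i. i \<in> I \<Longrightarrow> G i \<in> measurable M (count_space UNIV)"
    and joint: "\<And>g. prob {w \<in> space M. \<forall>i\<in>I. G i w = g i} = (\<Prod>i\<in>I. pmf (p i) (g i))"
  shows "indep_vars (\<lambda>_. count_space UNIV) G I"
proof (cases "I = {}")
  case True
  then show ?thesis by (simp add: indep_vars_def2 indep_sets_def)
next
  case ne: False
  fix dflt :: 'b
  \<comment> \<open>The vector as a total function, with a default value off \<open>I\<close>, to match \<open>Pi_pmf\<close>.\<close>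
  define V where "V w = (\<lambda>i. if i \<in> I then G i w else dflt)" for w
  define R where "R = PiE_dflt I dflt (\<lambda>_. UNIV :: 'b set)"
  define Q where "Q = Pi_pmf I dflt p"
  have VR: "V w \<in> R" for w by (auto simp: V_def R_def PiE_dflt_def)
  have countR: "countable R"
  proof -
    have "R \<subseteq> (\<lambda>f i. if i \<in> I then f i else dflt) ` PiE I (\<lambda>_. UNIV)"
    proof
      fix f assume "f \<in> R"
      then have "f = (\<lambda>i. if i \<in> I then restrict f I i else dflt)"
        by (auto simp: R_def PiE_dflt_def fun_eq_iff)
      then show "f \<in> (\<lambda>f i. if i \<in> I then f i else dflt) ` PiE I (\<lambda>_. UNIV)"
        by (intro image_eqI[of _ _ "restrict f I"]) auto
    qed
    moreover have "countable ((\<lambda>f i. if i \<in> I then f i else dflt) ` PiE I (\<lambda>_. UNIV :: 'b set))"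
      using fin by (intro countable_image countable_PiE) auto
    ultimately show ?thesis by (rule countable_subset)
  qed
  have V_single: "V -` {f} \<inter> space M = {w \<in> space M. \<forall>i\<in>I. G i w = f i}" if "f \<in> R" for f
    using that by (auto simp: V_def R_def PiE_dflt_def fun_eq_iff)
  have single_ev: "V -` {f} \<inter> space M \<in> sets M" if "f \<in> R" for f
  proof -
    have "{w \<in> space M. \<forall>i\<in>I. G i w = f i} = (\<Inter>i\<in>I. G i -` {f i} \<inter> space M)" using ne by auto
    also have "\<dots> \<in> sets M" using fin ne meas by (intro sets.finite_INT) (auto intro: measurable_sets)
    finally show ?thesis using V_single[OF that] by simp
  qed
  have V_meas: "V \<in> measurable M (count_space UNIV)"
  proof (rule measurableI)
    fix S :: "('i \<Rightarrow> 'b) set"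
    have "V -` S \<inter> space M = (\<Union>f\<in>R \<inter> S. V -` {f} \<inter> space M)" using VR by auto
    also have "\<dots> \<in> sets M" using countR single_ev by (intro sets.countable_UN') auto
    finally show "V -` S \<inter> space M \<in> sets M" .
  qed auto
  have D: "distr M (count_space UNIV) V = measure_pmf Q"
  proof (rule measure_eqI_countable_AE[of _ _ R])
    show "AE x in distr M (count_space UNIV) V. x \<in> R"
      using V_meas VR by (subst AE_distr_iff) auto
    show "AE x in measure_pmf Q. x \<in> R"
      using fin by (auto simp: AE_measure_pmf_iff Q_def R_def set_Pi_pmf PiE_dflt_def)
    fix f assume f: "f \<in> R"
    have "emeasure (distr M (count_space UNIV) V) {f} = prob (V -` {f} \<inter> space M)"
      using V_meas by (subst emeasure_distr) (auto simp: emeasure_eq_measure)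
    also have "\<dots> = (\<Prod>i\<in>I. pmf (p i) (f i))" using V_single[OF f] joint by simp
    also have "\<dots> = pmf Q f" unfolding Q_def
      using f fin by (subst pmf_Pi') (auto simp: R_def PiE_dflt_def)
    finally show "emeasure (distr M (count_space UNIV) V) {f} = emeasure (measure_pmf Q) {f}"
      by (simp add: emeasure_pmf_single)
  qed (use countR in auto)
  have "prob_space.indep_vars (measure_pmf Q) (\<lambda>_. count_space UNIV) (\<lambda>x f. f x) I"
    unfolding Q_def by (rule indep_vars_Pi_pmf[OF fin])
  then have "distr Q (\<Pi>\<^sub>M i\<in>I. count_space UNIV) (\<lambda>f. \<lambda>i\<in>I. f i)
      = (\<Pi>\<^sub>M i\<in>I. distr Q (count_space UNIV) (\<lambda>f. f i))"
    by (subst (asm) prob_space.indep_vars_iff_distr_eq_PiM'[OF measure_pmf.prob_space_axioms ne]) auto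
  also have "distr Q (\<Pi>\<^sub>M i\<in>I. count_space UNIV) (\<lambda>f. \<lambda>i\<in>I. f i)
      = distr M (\<Pi>\<^sub>M i\<in>I. count_space UNIV) (\<lambda>w. \<lambda>i\<in>I. G i w)"
    unfolding D[symmetric]
    by (subst distr_distr[OF _ V_meas]) (auto simp: o_def V_def space_PiM intro!: distr_cong)
  also have "(\<Pi>\<^sub>M i\<in>I. distr Q (count_space UNIV) (\<lambda>f. f i))
      = (\<Pi>\<^sub>M i\<in>I. distr M (count_space UNIV) (G i))"
    unfolding D[symmetric]
    by (intro PiM_cong refl, subst distr_distr[OF _ V_meas]) (auto simp: o_def V_def intro!: distr_cong)
  finally show ?thesis
    using meas by (subst indep_vars_iff_distr_eq_PiM'[OF ne]) auto
qed

text \<open>Regrouping a product over the steps of a path by visited state: each state entered is also left,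
  except the last one, and the first one is left only.\<close>

lemma prod_mult_shift:
  fixes f h :: "nat \<Rightarrow> 'b::comm_semiring_1" and Z :: "nat \<Rightarrow> nat"
  shows "(\<Prod>b\<in>{1..T}. f (Z b) * h (Z (b - 1))) * h (Z T) = h (Z 0) * (\<Prod>b\<in>{1..T}. f (Z b) * h (Z b))"
proof (induction T)
  case (Suc T)
  have "(\<Prod>b\<in>{1..Suc T}. f (Z b) * h (Z (b - 1))) * h (Z (Suc T))
      = ((\<Prod>b\<in>{1..T}. f (Z b) * h (Z (b - 1))) * h (Z T)) * (f (Z (Suc T)) * h (Z (Suc T)))"
    by (simp add: mult_ac)
  also have "\<dots> = h (Z 0) * (\<Prod>b\<in>{1..Suc T}. f (Z b) * h (Z b))"
    unfolding Suc by (simp add: mult_ac)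
  finally show ?case .
qed simp

context iid_residual_sample
begin

abbreviation gaps :: "nat \<Rightarrow> nat \<Rightarrow> 'a \<Rightarrow> nat" where
  "gaps n \<equiv> \<lambda>i w. gap (\<lambda>j. X j w) n i"

lemma open_unit_distribution_factor: "open_unit_distribution (distr M borel (H 1))"
proof -
  interpret D: prob_space "distr M borel (H 1)" by (rule prob_space_distr) simp
  show ?thesis
  proof unfold_locales
    show "AE x in distr M borel (H 1). 0 < x \<and> x < 1"
      using H_range[of 1] by (subst AE_distr_iff) auto
  qed simp_all
qed

lemma factor_moment_eq_mixed_moment: "factor_moment k l = (\<integral>x. x ^ k * (1 - x) ^ l \<partial>distr M borel (H 1))"
  unfolding factor_moment_def by (subst integral_distr) auto

lemma factor_moment_pos: "0 < factor_moment k l"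
  using open_unit_distribution.mixed_moment_pos[OF open_unit_distribution_factor]
  unfolding factor_moment_eq_mixed_moment open_unit_distribution.mixed_moment_def[OF open_unit_distribution_factor] .

lemma distributed_beta1_iff:
  "distributed M lborel (H 1) (\<lambda>x. ennreal (beta1_density \<theta> x)) \<longleftrightarrow> distr M borel (H 1) = beta1 \<theta>"
proof -
  have "distr M lborel (H 1) = distr M borel (H 1)" by (rule distr_cong) auto
  then show ?thesis by (auto simp: distributed_def beta1_def)
qed

text \<open>For beta\<open>(1, \<theta>)\<close> factors the moment at a step of \<open>Z\<close>, divided by the factorial of the step size,
  splits into \<open>f\<close> of the new value times \<open>h\<close> of the old one. By \<open>prod_mult_shift\<close> the probability of a
  path depends only on its occupation times, each visit to \<open>i\<close> costing the factor
  \<open>f i * h i = \<theta> / (i + \<theta>)\<close>.\<close>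

lemma prob_gaps_beta1:
  assumes \<theta>: "0 < \<theta>" and H: "distr M borel (H 1) = beta1 \<theta>"
  shows "prob {w \<in> space M. \<forall>i\<in>{1..n}. gaps n i w = g i}
           = (\<Prod>i\<in>{1..n}. pmf (geometric_pmf (real i / (real i + \<theta>))) (g i))"
proof -
  let ?A = "mset_of_gaps n g"
  let ?T = "pos_of_gaps n g n"
  let ?Z = "num_above ?A"
  define f h where "f z = Gamma (real z + \<theta>)" and "h z = \<theta> / Gamma (real z + 1 + \<theta>)" for z
  define q where "q z = \<theta> / (real z + \<theta>)" for z
  have fh: "f z * h z = q z" for z
    using Gamma_plus1_pos[of "real z + \<theta>"] Gamma_nonzero_pos[of "real z + \<theta>"] \<theta>
    by (simp add: f_def h_def q_def add_ac)
  have moment: "factor_moment (count ?A b) (?Z b) / fact (count ?A b) = f (?Z b) * h (?Z (b - 1))" if "1 \<le> b" for b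
  proof -
    have "real (count ?A b) + real (?Z b) = real (?Z (b - 1))"
      using count_plus_num_above[OF that, of ?A] by linarith
    then show ?thesis
      unfolding factor_moment_eq_mixed_moment H integral_beta1[OF \<theta>] by (simp add: f_def h_def)
  qed
  have Z0: "?Z 0 = n"
  proof -
    have "{#x \<in># ?A. 0 < x#} = ?A"
      using pos_of_gaps_ge_1 by (auto simp: filter_mset_eq_conv mset_of_gaps_def less_eq_Suc_le simp del: upt_Suc)
    then show ?thesis by (simp add: num_above_def)
  qed
  have ZT: "?Z ?T = 0"
    using num_above_mset_of_gaps[of n n g ?T] by simp
  have "prob {w \<in> space M. \<forall>i\<in>{1..n}. gaps n i w = g i} = fact n * (\<Prod>b\<in>{1..?T}. f (?Z b) * h (?Z (b - 1)))"
    unfolding prob_gaps[OF order_refl] using moment by simp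
  also have "\<dots> = fact n * (h n / h 0 * (\<Prod>b\<in>{1..?T}. f (?Z b) * h (?Z b)))"
  proof -
    have "h 0 \<noteq> 0" using \<theta> Gamma_nonzero_pos[of "1 + \<theta>"] by (auto simp: h_def)
    then show ?thesis using prod_mult_shift[of f ?Z h ?T] by (simp add: Z0 ZT field_simps)
  qed
  also have "(\<Prod>b\<in>{1..?T}. f (?Z b) * h (?Z b)) = (\<Prod>i\<in>{1..n}. q i ^ g i)"
    unfolding fh by (rule prod_num_above_eq_prod_gaps) (use \<theta> in \<open>simp add: q_def\<close>)
  also have "fact n * (h n / h 0 * (\<Prod>i\<in>{1..n}. q i ^ g i)) = (fact n * (h n / h 0)) * (\<Prod>i\<in>{1..n}. q i ^ g i)"
    by simp
  \<comment> \<open>What is left over are the normalizing constants of the geometric laws.\<close>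
  also have "fact n * (h n / h 0) = (\<Prod>i\<in>{1..n}. real i / (real i + \<theta>))"
  proof (induction n)
    case 0
    then show ?case using \<theta> Gamma_nonzero_pos[of "1 + \<theta>"] by (simp add: h_def)
  next
    case (Suc n)
    have "h (Suc n) = h n / (real (Suc n) + \<theta>)"
      using Gamma_plus1_pos[of "real (Suc n) + \<theta>"] \<theta> by (simp add: h_def add_ac)
    then have "fact (Suc n) * (h (Suc n) / h 0) = (fact n * (h n / h 0)) * (real (Suc n) / (real (Suc n) + \<theta>))"
      by (simp add: mult_ac)
    then show ?case unfolding Suc by simp
  qed
  also have "\<dots> * (\<Prod>i\<in>{1..n}. q i ^ g i) = (\<Prod>i\<in>{1..n}. real i / (real i + \<theta>) * q i ^ g i)"
    by (simp only: prod.distrib)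
  also have "\<dots> = (\<Prod>i\<in>{1..n}. pmf (geometric_pmf (real i / (real i + \<theta>))) (g i))"
  proof (rule prod.cong[OF refl])
    fix i assume "i \<in> {1..n}"
    then have "0 < real i / (real i + \<theta>)" "real i / (real i + \<theta>) \<le> 1" "q i = 1 - real i / (real i + \<theta>)"
      using \<theta> by (auto simp: q_def field_simps)
    then show "real i / (real i + \<theta>) * q i ^ g i = pmf (geometric_pmf (real i / (real i + \<theta>))) (g i)"
      by simp
  qed
  finally show ?thesis .
qed

lemma indep_gaps_if_beta1:
  assumes "0 < \<theta>" "distr M borel (H 1) = beta1 \<theta>"
  shows "indep_vars (\<lambda>_. count_space UNIV) (gaps n) {1..n}"
  by (rule indep_vars_if_joint_pmf_product[OF _ gap_meas prob_gaps_beta1[OF assms]]) auto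

end

section \<open>Independent gaps force beta factors\<close>

definition two_gaps :: "nat \<Rightarrow> nat \<Rightarrow> nat \<Rightarrow> nat \<Rightarrow> nat" where
  "two_gaps j a b i = (if i = j then a else if i = 1 then b else 0)"

lemma pos_of_two_gaps:
  assumes j: "1 < j" "j < n" and k: "1 \<le> k" "k \<le> n"
  shows "pos_of_gaps n (two_gaps j a b) k = 1 + (if n - j < k then a else 0) + (if k = n then b else 0)"
proof -
  have "(\<Sum>i\<in>{n + 1 - k..n}. two_gaps j a b i)
      = (\<Sum>i\<in>{n + 1 - k..n}. (if i = j then a else 0) + (if i = 1 then b else 0))"
    using j by (intro sum.cong) (auto simp: two_gaps_def)
  also have "\<dots> = (if n - j < k then a else 0) + (if k = n then b else 0)"
    using j k by (auto simp: sum.distrib sum.delta)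
  finally show ?thesis by (simp add: pos_of_gaps_def)
qed

lemma mset_of_two_gaps:
  assumes j: "1 < j" "j < n"
  shows "mset_of_gaps n (two_gaps j a b)
           = replicate_mset (n - j) 1 + replicate_mset (j - 1) (1 + a) + replicate_mset 1 (1 + a + b)"
proof -
  let ?p = "pos_of_gaps n (two_gaps j a b)"
  have "[1..<Suc n] = [1..<Suc (n - j)] @ [Suc (n - j)..<n] @ [n]"
    using j upt_add_eq_append[of 1 "Suc (n - j)" "j - 1"] by (simp add: Suc_diff_le)
  moreover have "map ?p [1..<Suc (n - j)] = replicate (n - j) 1"
    using j pos_of_two_gaps[OF j] by (intro nth_equalityI) (auto simp del: upt_Suc)
  moreover have "map ?p [Suc (n - j)..<n] = replicate (j - 1) (1 + a)"
    using j pos_of_two_gaps[OF j] by (intro nth_equalityI) (auto simp del: upt_Suc)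
  moreover have "?p n = 1 + a + b" using j pos_of_two_gaps[OF j, of n] by simp
  ultimately show ?thesis unfolding mset_of_gaps_def by (simp del: upt_Suc)
qed

context iid_residual_sample
begin

text \<open>Independence makes the probability \<open>p a b\<close> of \<open>two_gaps j a b\<close> a product of a function of \<open>a\<close>
  and a function of \<open>b\<close>, whence \<open>p 1 1 * p 0 0 = p 1 0 * p 0 1\<close>. Writing out the four
  probabilities, everything except the stated identity cancels.\<close>

lemma moment_identity_if_indep:
  assumes indep: "indep_vars (\<lambda>_. count_space UNIV) (gaps n) {1..n}"
    and j: "1 < j" "j < n"
  shows "real j * factor_moment (j - 1) 1 * factor_moment n 0 = real n * factor_moment (n - 1) 1 * factor_moment j 0"
proof -
  have moment_0_0: "factor_moment 0 0 = 1" by (simp add: factor_moment_def prob_space)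
  define p where "p a b = prob {w \<in> space M. \<forall>i\<in>{1..n}. gaps n i w = two_gaps j a b i}" for a b
  define F where "F i v = prob ((\<lambda>w. gaps n i w) -` {v} \<inter> space M)" for i v
  have "p a b = F j a * F 1 b * (\<Prod>i\<in>{1..n} - {j, 1}. F i 0)" for a b
  proof -
    have "p a b = prob (\<Inter>i\<in>{1..n}. (\<lambda>w. gaps n i w) -` {two_gaps j a b i} \<inter> space M)"
      using j unfolding p_def by (intro arg_cong[where f = prob]) auto
    also have "\<dots> = (\<Prod>i\<in>{1..n}. F i (two_gaps j a b i))"
      unfolding F_def using j by (intro indep_varsD_finite[OF indep]) auto
    also have "\<dots> = F j a * F 1 b * (\<Prod>i\<in>{1..n} - {j, 1}. F i (two_gaps j a b i))"
    proof -
      have "{1..n} = insert j (insert 1 ({1..n} - {j, 1}))" using j by auto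
      then have "(\<Prod>i\<in>{1..n}. F i (two_gaps j a b i))
          = (\<Prod>i\<in>insert j (insert 1 ({1..n} - {j, 1})). F i (two_gaps j a b i))" by simp
      also have "\<dots> = F j a * F 1 b * (\<Prod>i\<in>{1..n} - {j, 1}. F i (two_gaps j a b i))"
        using j by (simp add: two_gaps_def)
      finally show ?thesis .
    qed
    also have "(\<Prod>i\<in>{1..n} - {j, 1}. F i (two_gaps j a b i)) = (\<Prod>i\<in>{1..n} - {j, 1}. F i 0)"
      by (intro prod.cong refl) (auto simp: two_gaps_def)
    finally show ?thesis .
  qed
  then have product_rule: "p 1 1 * p 0 0 = p 1 0 * p 0 1" by simp
  have p_eq: "p a b = fact n * (\<Prod>i\<in>{1,2,3}. factor_moment (count (mset_of_gaps n (two_gaps j a b)) i)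
      (num_above (mset_of_gaps n (two_gaps j a b)) i) / fact (count (mset_of_gaps n (two_gaps j a b)) i))"
    if "a \<le> 1" "b \<le> 1" for a b
  proof -
    have "{1..3} = {1, 2, 3::nat}" by auto
    moreover have "pos_of_gaps n (two_gaps j a b) n \<le> 3" using that j pos_of_two_gaps[OF j, of n] by simp
    ultimately show ?thesis unfolding p_def using prob_gaps[of n "two_gaps j a b" 3] by (simp only:)
  qed
  note simps = mset_of_two_gaps[OF j] num_above_union num_above_replicate_mset num_above_add_mset
    num_above_empty moment_0_0
  have n: "n - j + j = n" "n - j + (j - 1) = n - 1" "fact n = real n * fact (n - 1)" "fact j = real j * fact (j - 1)"
    using j fact_reduce[of n] fact_reduce[of j] by auto
  define K where "K = fact n * factor_moment (n - j) j / (fact (n - j) * fact j)"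
  have "p 0 0 = factor_moment n 0"
    using j n by (simp add: p_eq simps)
  moreover have "p 0 1 = real n * (factor_moment (n - 1) 1 * factor_moment 1 0)"
    using j n by (simp add: p_eq simps)
  moreover have "p 1 0 = K * factor_moment j 0"
    using j n by (simp add: p_eq simps K_def)
  moreover have "p 1 1 = K * (real j * factor_moment (j - 1) 1 * factor_moment 1 0)"
    using j n by (simp add: p_eq simps K_def)
  ultimately have "(K * factor_moment 1 0) * (real j * factor_moment (j - 1) 1 * factor_moment n 0)
      = (K * factor_moment 1 0) * (real n * factor_moment (n - 1) 1 * factor_moment j 0)"
    using product_rule by (simp only: mult_ac)
  moreover have "K * factor_moment 1 0 \<noteq> 0" using factor_moment_pos[of "n - j" j] factor_moment_pos[of 1 0] by (simp add: K_def)
  ultimately show ?thesis by (simp only: mult_cancel_left simp_thms)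
qed

lemma beta1_if_eventually_indep_gaps:
  assumes "\<forall>\<^sub>F n in sequentially. indep_vars (\<lambda>_. count_space UNIV) (gaps n) {1..n}"
  shows "\<exists>\<theta>>0. distr M borel (H 1) = beta1 \<theta>"
proof -
  define R where "R j = real j * factor_moment (j - 1) 1 / factor_moment j 0" for j
  obtain N where N: "\<And>n. N \<le> n \<Longrightarrow> indep_vars (\<lambda>_. count_space UNIV) (gaps n) {1..n}"
    using assms by (auto simp: eventually_sequentially)
  \<comment> \<open>\<open>R j\<close> is the ratio of the transition probabilities of \<open>Z\<close> from \<open>j\<close> to \<open>1\<close> and from \<open>j\<close> to \<open>0\<close>.\<close>
  have R_eq: "R j = R n" if "N \<le> n" "1 < j" "j < n" for j n
    using moment_identity_if_indep[OF N[OF that(1)] that(2,3)] factor_moment_pos[of n 0] factor_moment_pos[of j 0]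
    by (simp add: R_def field_simps)
  \<comment> \<open>Any sample size above both \<open>N\<close> and \<open>j\<close> links \<open>R j\<close> to \<open>R 2\<close>.\<close>
  have R: "R j = R 2" if "2 \<le> j" for j
    using R_eq[of "N + j + 1" j] R_eq[of "N + j + 1" 2] that by simp
  have "0 < R 2" using factor_moment_pos by (simp add: R_def)
  moreover have "distr M borel (H 1) = beta1 (R 2)"
  proof (rule eq_beta1I[OF open_unit_distribution_factor \<open>0 < R 2\<close>])
    fix j :: nat assume "2 \<le> j"
    then have "real j * factor_moment (j - 1) 1 = R 2 * factor_moment j 0"
      using R[of j] factor_moment_pos[of j 0] by (simp add: R_def field_simps)
    then show "real j * (\<integral>x. x ^ (j - 1) * (1 - x) \<partial>distr M borel (H 1)) = R 2 * (\<integral>x. x ^ j \<partial>distr M borel (H 1))"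
      by (simp add: factor_moment_eq_mixed_moment)
  qed
  ultimately show ?thesis by blast
qed

end

theorem corollary1p2:
  fixes M :: "'a measure"
    and H :: "nat \<Rightarrow> 'a \<Rightarrow> real"
    and X :: "nat \<Rightarrow> 'a \<Rightarrow> nat"
  assumes "prob_space M"
    and "iid_factors M H"
    and "iid_sample_from M (residual_allocation H) X"
  shows "(\<forall>\<^sub>F n in sequentially.
            prob_space.indep_vars M (\<lambda>_. count_space UNIV)
              (\<lambda>i w. gap (\<lambda>j. X j w) n i) {1..n})
         \<longleftrightarrow> (\<exists>\<theta>>0. distributed M lborel (H 1) (\<lambda>x. ennreal (beta1_density \<theta> x)))"
proof -
  interpret iid_residual_sample M H X
    using assms by (intro iid_residual_sample.intro iid_residual_sample_axioms.intro)
  show ?thesis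
    unfolding distributed_beta1_iff
  proof
    assume "\<exists>\<theta>>0. distr M borel (H 1) = beta1 \<theta>"
    then obtain \<theta> where "0 < \<theta>" "distr M borel (H 1) = beta1 \<theta>" by blast
    then have "indep_vars (\<lambda>_. count_space UNIV) (gaps n) {1..n}" for n
      by (rule indep_gaps_if_beta1)
    then show "\<forall>\<^sub>F n in sequentially. indep_vars (\<lambda>_. count_space UNIV) (gaps n) {1..n}"
      by (rule always_eventually[OF allI])
  qed (rule beta1_if_eventually_indep_gaps)
qed

end
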